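(* Let $g$ be a positive integer. Then the limit $\lim_{n\to\infty} \frac{\eta_g(n)}{\sqrt{n}}$ exists and is a positive real number.
   Context: For a positive integer $n$ write $[n]=\{1,2,\dots,n\}$. For a set $A$ of integers and an integer $d$, let $r_{A-A}(d)=|\{(a,a')\in A\times A : d=a-a'\}|$. A set $A\subseteq\mathbb{Z}$ is a $g$-difference basis for $[n]$ if $r_{A-A}(x)\ge g$ for every $x\in[n]$. Define $\eta_g(n)=\min\{|A| : A\subseteq \mathbb{Z},\ r_{A-A}(x)\ge g \text{ for all } x\in[n]\}$. *)

theory Defs
  imports Complex_Main
begin

definition diff_rep :: "int set \<Rightarrow> int \<Rightarrow> nat" where
  "diff_rep A d = card {(a, a') \<in> A \<times> A. d = a - a'}"

text \<open>Since \<^const>\<open>card\<close> is \<open>0\<close> on infinite sets, \<open>diff_rep\<close> and the next predicate carry their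
  intended meaning for finite \<open>A\<close> only; they are used only for such \<open>A\<close> below.\<close>

definition difference_basis :: "nat \<Rightarrow> nat \<Rightarrow> int set \<Rightarrow> bool" where
  "difference_basis g n A \<longleftrightarrow> (\<forall>x \<in> {1..int n}. diff_rep A x \<ge> g)"

text \<open>Restricting to finite \<open>A\<close> does not change the minimum: the finite set \<open>{0..n+g}\<close> is a
  \<open>g\<close>-difference basis for \<open>[n]\<close>, so the minimal cardinality is finite, and without
  the restriction infinite sets would count as having cardinality \<open>0\<close>.\<close>

definition eta :: "nat \<Rightarrow> nat \<Rightarrow> nat" where
  "eta g n = (LEAST k. \<exists>A. finite A \<and> difference_basis g n A \<and> card A = k)"

end

theory Submission
  imports Defs "HOL-Algebra.Algebraic_Closure_Type" "HOL-Analysis.Kronecker_Approximation_Theorem"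
begin

text \<open>
  If the differences of \<open>D \<subseteq> [0, N)\<close> cover all residues modulo \<open>N\<close> and \<open>A\<close> is a
  \<open>g\<close>-difference basis for \<open>[n]\<close>, then \<open>N A + D\<close> is a \<open>g\<close>-difference basis for \<open>[n N]\<close>,
  whence \<open>\<eta>(n N) \<le> |D| \<eta>(n)\<close>. Singer's construction provides such \<open>D\<close> with
  \<open>N = q\<^sup>2 + q + 1\<close> and \<open>|D| \<le> q + 1\<close> for every prime power \<open>q\<close>.

  Restricting \<open>q\<close> to primes would call for the prime number theorem, in order to have suitable \<open>q\<close> in
  all short intervals. Instead we apply the inequality twice, with \<open>q = 2\<^sup>a\<close> and \<open>q = 3\<^sup>b\<close>.
  As \<open>ln 2 / ln 3\<close> is irrational, the numbers \<open>2\<^sup>a 3\<^sup>b\<close> with \<open>a, b \<ge> K\<close> have consecutive ratios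
  tending to 1, so that \<open>limsup \<eta>(m) / \<surd>m \<le> \<eta>(n) / \<surd>n\<close> for every \<open>n > 0\<close>. The limit is therefore the
  infimum of \<open>\<eta>(n) / \<surd>n\<close>, which is at least 1 by counting differences.
\<close>

subsection \<open>Difference bases and difference covers modulo N\<close>

text \<open>Residues are represented in \<open>[0, N)\<close> so that \<open>d - d'\<close> lies
  strictly between \<open>-N\<close> and \<open>N\<close>; this bounds the quotient in
  \<open>eta_mult_le\<close>.\<close>

definition difference_cover :: "nat \<Rightarrow> int set \<Rightarrow> bool" where
  "difference_cover N D \<longleftrightarrow>
    D \<subseteq> {0..<int N} \<and> (\<forall>r. \<exists>d\<in>D. \<exists>d'\<in>D. int N dvd r - (d - d'))"

lemma eta_le_card:
  "finite A \<Longrightarrow> difference_basis g n A \<Longrightarrow> eta g n \<le> card A"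
  unfolding eta_def by (rule Least_le) blast

lemma finite_diff_pairs: "finite A \<Longrightarrow> finite {(a, a') \<in> A \<times> A. (d::int) = a - a'}"
  by (rule finite_subset[of _ "A \<times> A"]) auto

text \<open>The pairs \<open>(x + i, i)\<close> with \<open>0 \<le> i < g\<close> represent
  \<open>x\<close>. This witness makes the \<open>LEAST\<close> in \<open>eta\<close>
  attained.\<close>

lemma difference_basis_interval: "difference_basis g n {0..int n + int g}"
  unfolding difference_basis_def diff_rep_def
proof
  fix x assume x: "x \<in> {1..int n}"
  let ?A = "{0..int n + int g}"
  have "g = card ((\<lambda>i. (x + i, i)) ` {0..<int g})"
    by (subst card_image) (auto simp: inj_on_def)
  also have "\<dots> \<le> card {(a, a') \<in> ?A \<times> ?A. x = a - a'}"
    by (rule card_mono[OF finite_diff_pairs]) (use x in auto)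
  finally show "g \<le> card {(a, a') \<in> ?A \<times> ?A. x = a - a'}" .
qed

lemma eta_attained:
  obtains A where "finite A" "difference_basis g n A" "card A = eta g n"
proof -
  have "\<exists>A. finite A \<and> difference_basis g n A \<and> card A = eta g n"
    unfolding eta_def
    by (rule LeastI_ex) (use difference_basis_interval in blast)
  then show ?thesis using that by blast
qed

lemma eta_mono:
  assumes "m \<le> n"
  shows "eta g m \<le> eta g n"
proof -
  obtain A where "finite A" "difference_basis g n A" "card A = eta g n"
    by (rule eta_attained)
  with assms eta_le_card[of A g m] show ?thesis
    by (auto simp: difference_basis_def)
qed

lemma diff_rep_le_card:
  assumes "finite A"
  shows "diff_rep A x \<le> card A"
  unfolding diff_rep_def
  by (rule card_inj_on_le[of fst]) (use assms in \<open>auto simp: inj_on_def\<close>)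

lemma diff_rep_zero: "diff_rep A 0 = card A"
proof -
  have "{(a, a') \<in> A \<times> A. 0 = a - a'} = (\<lambda>a. (a, a)) ` A" by auto
  then show ?thesis by (simp add: diff_rep_def card_image inj_on_def)
qed

text \<open>Write \<open>x = k N + (d - d')\<close> with \<open>d\<close>, \<open>d'\<close> in
  \<open>D\<close>. Each representation \<open>k = a - a'\<close> lifts to
  \<open>x = (a N + d) - (a' N + d')\<close>, so \<open>x\<close> inherits the representations of
  \<open>k\<close>.\<close>

lemma eta_mult_le:
  assumes n: "n > 0" and D: "difference_cover N D"
  shows "eta g (n * N) \<le> card D * eta g n"
proof -
  obtain A where A: "finite A" "difference_basis g n A" "card A = eta g n"
    by (rule eta_attained)
  have finD: "finite D" using D by (auto simp: difference_cover_def intro: finite_subset)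
  have N: "N > 0" using D by (cases "N = 0") (auto simp: difference_cover_def)
  define B where "B = (\<lambda>(a, d). a * int N + d) ` (A \<times> D)"
  have finB: "finite B" using A finD by (simp add: B_def)
  \<comment> \<open>The quotient \<open>k\<close> can be 0, which lies outside \<open>[n]\<close>.
    But 0 has \<open>card A\<close> representations, at least as many as 1 has, and 1 is in
    \<open>[n]\<close> because \<open>n > 0\<close>.\<close>
  have rep: "diff_rep A k \<ge> g" if "0 \<le> k" "k \<le> int n" for k
  proof (cases "k = 0")
    case True
    have "g \<le> diff_rep A 1" using A(2) n by (simp add: difference_basis_def)
    also have "\<dots> \<le> card A" using A(1) by (rule diff_rep_le_card)
    finally show ?thesis using True by (simp add: diff_rep_zero)
  qed (use that A(2) in \<open>auto simp: difference_basis_def\<close>)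
  have "difference_basis g (n * N) B"
    unfolding difference_basis_def
  proof
    fix x assume x: "x \<in> {1..int (n * N)}"
    obtain d d' where d: "d \<in> D" "d' \<in> D" and "int N dvd x - (d - d')"
      using D unfolding difference_cover_def by blast
    then obtain k where k: "x - (d - d') = int N * k" by (auto elim: dvdE)
    have bnd: "0 \<le> d" "d < int N" "0 \<le> d'" "d' < int N"
      using d D by (auto simp: difference_cover_def)
    \<comment> \<open>From \<open>1 \<le> x \<le> n N\<close> and \<open>|d - d'| < N\<close>, the
      product \<open>N k\<close> lies strictly between \<open>-N\<close> and
      \<open>N (n + 1)\<close>.\<close>
    have "int N * (- 1) < int N * k" using k x bnd by auto
    then have k0: "0 \<le> k" using N by (subst (asm) mult_less_cancel_left_pos) auto
    have "int N * k < int N * (int n + 1)" using k x bnd by (auto simp: algebra_simps)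
    then have kn: "k \<le> int n" using N by (subst (asm) mult_less_cancel_left_pos) auto
    have "g \<le> diff_rep A k" using rep k0 kn .
    also have "\<dots> \<le> diff_rep B x"
      unfolding diff_rep_def
    proof (rule card_inj_on_le[OF _ _ finite_diff_pairs[OF finB]])
      let ?f = "\<lambda>(a, a'). (a * int N + d, a' * int N + d')"
      show "inj_on ?f {(a, a') \<in> A \<times> A. k = a - a'}"
        using N by (auto simp: inj_on_def)
      have "(a - a') * int N + (d - d') = x" if "k = a - a'" for a a'
        using k that by (simp add: algebra_simps)
      then show "?f ` {(a, a') \<in> A \<times> A. k = a - a'} \<subseteq> {(a, a') \<in> B \<times> B. x = a - a'}"
        using d by (fastforce simp: B_def algebra_simps)
    qed
    finally show "g \<le> diff_rep B x" .
  qed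
  then have "eta g (n * N) \<le> card B" using finB eta_le_card by blast
  also have "\<dots> \<le> card (A \<times> D)" unfolding B_def
    by (rule card_image_le) (use A finD in simp)
  finally show ?thesis using A by (simp add: card_cartesian_product mult.commute)
qed

lemma le_eta_square:
  assumes "g > 0"
  shows "n \<le> (eta g n)\<^sup>2"
proof -
  obtain A where A: "finite A" "difference_basis g n A" "card A = eta g n"
    by (rule eta_attained)
  have "x \<in> (\<lambda>(a, a'). a - a') ` (A \<times> A)" if "x \<in> {1..int n}" for x
  proof -
    have "diff_rep A x > 0" using A(2) that assms by (force simp: difference_basis_def)
    then have "{(a, a') \<in> A \<times> A. x = a - a'} \<noteq> {}" unfolding diff_rep_def by (metis card.empty less_irrefl)
    then show ?thesis by auto
  qed
  then have "card {1..int n} \<le> card ((\<lambda>(a, a'). a - a') ` (A \<times> A))"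
    by (intro card_mono) (use A in auto)
  also have "\<dots> \<le> card (A \<times> A)" by (rule card_image_le) (use A in simp)
  finally show ?thesis using A by (simp add: card_cartesian_product power2_eq_square)
qed


subsection \<open>Singer difference covers\<close>

lemma finite_subfield_generator:
  fixes F :: "'a::field set"
  assumes fin: "finite F" and one: "1 \<in> F"
    and diff: "\<And>x y. x \<in> F \<Longrightarrow> y \<in> F \<Longrightarrow> x - y \<in> F"
    and mult: "\<And>x y. x \<in> F \<Longrightarrow> y \<in> F \<Longrightarrow> x * y \<in> F"
    and inver: "\<And>x. x \<in> F \<Longrightarrow> inverse x \<in> F"
  shows "\<exists>\<gamma>. F - {0} = range (\<lambda>i::nat. \<gamma> ^ i)"
proof -
  \<comment> \<open>Packing \<open>F\<close> as a ring record makes the cyclicity of the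
    multiplicative group of a finite field applicable.\<close>
  define R :: "'a ring" where
    "R = \<lparr>carrier = F, monoid.mult = (*), one = 1, ring.zero = 0, add = (+)\<rparr>"
  have zero: "0 \<in> F" using diff[OF one one] by simp
  have uminus: "- x \<in> F" if "x \<in> F" for x using diff[OF zero that] by simp
  have plus: "x + y \<in> F" if "x \<in> F" "y \<in> F" for x y using diff[OF that(1) uminus[OF that(2)]] by simp
  have neg: "\<exists>y\<in>F. x + y = 0" if "x \<in> F" for x
    using uminus[OF that] by (intro bexI[of _ "- x"]) auto
  have invs: "\<exists>y\<in>F. x * y = 1" if "x \<in> F" "x \<noteq> 0" for x
    using inver[OF that(1)] that(2) by (intro bexI[of _ "inverse x"]) auto
  have "field R"
    unfolding R_def
    by unfold_locales
      (use zero one plus mult neg invs in \<open>auto simp: algebra_simps Units_def\<close>)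
  then interpret R: field R .
  have pow: "x [^]\<^bsub>R\<^esub> i = x ^ i" for x and i :: nat
    by (induction i) (auto simp: R_def nat_pow_def mult.commute)
  have "finite (carrier R)" using fin by (simp add: R_def)
  from R.finite_field_mult_group_has_gen[OF this] obtain \<gamma>
    where "carrier R - {\<zero>\<^bsub>R\<^esub>} = {\<gamma> ^ i |i::nat. i \<in> UNIV}"
    unfolding pow by (auto simp: carrier_mult_of)
  then have "F - {0} = range (\<lambda>i::nat. \<gamma> ^ i)"
    by (auto simp: R_def)
  then show ?thesis by blast
qed

text \<open>The fixed points are the roots of \<open>X^q - X\<close>, which splits and is separable:
  its derivative is \<open>-1\<close>, as \<open>q = 0\<close> in the field.\<close>

lemma card_frobenius_fixed_points:
  assumes p: "prime CHAR('a::alg_closed_field)" and "k > 0"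
  shows "card {x::'a. x ^ (CHAR('a) ^ k) = x} = CHAR('a) ^ k"
proof -
  define q where "q = CHAR('a) ^ k"
  have q1: "q > 1" unfolding q_def using prime_gt_1_nat[OF p] \<open>k > 0\<close> by (rule one_less_power)
  define P :: "'a poly" where "P = monom 1 q - monom 1 1"
  have deg: "degree P = q"
  proof -
    have "degree P = degree (monom (1::'a) q)" unfolding P_def diff_conv_add_uminus
      by (rule degree_add_eq_left) (use q1 in \<open>simp add: degree_monom_eq\<close>)
    then show ?thesis by (simp add: degree_monom_eq)
  qed
  have P0: "P \<noteq> 0" using deg q1 by auto
  have lc: "lead_coeff P = 1" unfolding deg using q1 by (simp add: P_def)
  have "of_nat q = (0::'a)" unfolding of_nat_eq_0_iff_char_dvd q_def
    using \<open>k > 0\<close> by (simp add: dvd_power)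
  then have pd: "pderiv P = [:-1:]"
    by (simp add: P_def pderiv_diff pderiv_monom monom_0)
  obtain A where A: "size A = q" "P = (\<Prod>x\<in>#A. [:-x, 1:])"
    using alg_closed_imp_factorization[OF P0] unfolding lc unfolding deg by auto
  \<comment> \<open>A repeated root would also be a root of the derivative, the constant
    \<open>-1\<close>.\<close>
  have cnt: "count A x \<le> 1" for x
  proof (rule ccontr)
    assume "\<not> count A x \<le> 1"
    then have "{#x, x#} \<subseteq># A" by (intro mset_subset_eqI) (auto)
    then obtain B where "A = {#x, x#} + B" by (auto simp: subset_mset.le_iff_add)
    then have "P = [:-x, 1:] * ([:-x, 1:] * (\<Prod>x\<in>#B. [:-x, 1:]))" using A by simp
    then have "poly (pderiv P) x = 0" by (simp only: pderiv_mult) simp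
    then show False using pd by simp
  qed
  have roots: "set_mset A = {x. x ^ q = x}"
  proof -
    have "x \<in># A \<longleftrightarrow> poly P x = 0" for x
      unfolding A(2) by (auto simp: poly_prod_mset prod_mset_zero_iff)
    then show ?thesis by (auto simp: P_def poly_monom)
  qed
  have "A = mset_set (set_mset A)"
  proof (rule multiset_eqI)
    fix x show "count A x = count (mset_set (set_mset A)) x"
    proof (cases "x \<in># A")
      case True
      then have "1 \<le> count A x" by simp
      then have "count A x = 1" using cnt[of x] by linarith
      then show ?thesis using True by simp
    next
      case False
      then show ?thesis by (simp add: not_in_iff)
    qed
  qed
  then have "size A = size (mset_set (set_mset A))" by (rule arg_cong)
  then show ?thesis using A(1) roots by (simp add: q_def)
qed

text \<open>Additivity of Frobenius is applied to \<open>x = (x - y) + y\<close>, which avoids the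
  sign of \<open>(-1)^q\<close>.\<close>

lemma frobenius_fixed_points_subfield:
  fixes x y :: "'a::field"
  assumes p: "prime CHAR('a)" and q: "q = CHAR('a) ^ k" and xy: "x ^ q = x" "y ^ q = y"
  shows "(x - y) ^ q = x - y" "(x * y) ^ q = x * y" "(inverse x) ^ q = inverse x"
proof -
  have "x ^ q = (x - y) ^ q + y ^ q" using freshmans_dream'[OF p q, of "x - y" y] by simp
  then show "(x - y) ^ q = x - y" using xy by (simp add: algebra_simps)
qed (use xy in \<open>simp_all add: power_mult_distrib power_inverse\<close>)

section \<open>Singer's construction\<close>

text \<open>\<open>D\<close> lists the exponents modulo \<open>N\<close> of the nonzero elements of
  an \<open>E\<close>-plane \<open>W\<close> in \<open>F\<close>, that is, a line of the projective
  plane over \<open>E\<close>. For each \<open>s\<close>, the planes \<open>W\<close> and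
  \<open>\<gamma>^s W\<close> share a nonzero element, which makes \<open>s\<close> a difference of
  exponents.\<close>

lemma difference_cover_of_cubic_extension:
  fixes E F :: "'a::field set" and \<gamma> :: 'a
  assumes q: "q > 1"
    and cardE: "card E = q" and cardF: "card F = q ^ 3" and EF: "E \<subseteq> F"
    and E: "\<And>x. x \<in> E \<longleftrightarrow> x ^ q = x" and F: "\<And>x. x \<in> F \<longleftrightarrow> x ^ (q ^ 3) = x"
    and Ediff: "\<And>x y. x \<in> E \<Longrightarrow> y \<in> E \<Longrightarrow> x - y \<in> E"
    and Fdiff: "\<And>x y. x \<in> F \<Longrightarrow> y \<in> F \<Longrightarrow> x - y \<in> F"
    and gen: "F - {0} = range (\<lambda>i::nat. \<gamma> ^ i)"
  shows "\<exists>D. difference_cover (q\<^sup>2 + q + 1) D \<and> card D \<le> q + 1"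
proof -
  define N where "N = q\<^sup>2 + q + 1"
  define M where "M = q ^ 3 - 1"
  \<comment> \<open>\<open>M\<close> is the order of the group of units of \<open>F\<close>, and
    \<open>N\<close> the index in it of the units of \<open>E\<close>.\<close>
  have MN: "M = (q - 1) * N"
    using q unfolding M_def N_def
    by (cases q) (auto simp: power2_eq_square power3_eq_cube algebra_simps)
  have q3: "q ^ 3 = Suc M" using q by (simp add: M_def)
  have M0: "M > 0" using MN q by (simp add: N_def)
  have finE: "finite E" and finF: "finite F"
    using cardE cardF q by (auto intro!: card_ge_0_finite)
  have Emult: "x * y \<in> E" if "x \<in> E" "y \<in> E" for x y
    using that by (simp add: E power_mult_distrib)
  have Ediv: "x / y \<in> E" if "x \<in> E" "y \<in> E" for x y
    using that by (simp add: E power_divide)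
  have Fmult: "x * y \<in> F" if "x \<in> F" "y \<in> F" for x y
    using that by (simp add: F power_mult_distrib)
  have E0: "0 \<in> E" using q by (simp add: E)
  have Fadd: "x + y \<in> F" if "x \<in> F" "y \<in> F" for x y
    using Fdiff[OF that(1) Fdiff[OF _ that(2)], of 0] E0 EF by auto

  have "card E < card F" using q cardE cardF power_strict_increasing[of 1 3 q] by simp
  then obtain \<theta> where \<theta>: "\<theta> \<in> F" "\<theta> \<notin> E"
    using card_mono[OF finE, of F] by fastforce
  define W where "W = (\<lambda>(a, b). a + b * \<theta>) ` (E \<times> E)"
  \<comment> \<open>\<open>1\<close> and \<open>\<theta>\<close> are independent over
    \<open>E\<close>: a coincidence with \<open>b \<noteq> b'\<close> would exhibit
    \<open>\<theta>\<close> as a quotient of elements of \<open>E\<close>.\<close>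
  have injW: "inj_on (\<lambda>(a, b). a + b * \<theta>) (E \<times> E)"
  proof (rule inj_onI, clarify)
    fix a b a' b' assume m: "a \<in> E" "b \<in> E" "a' \<in> E" "b' \<in> E"
      and eq: "a + b * \<theta> = a' + b' * \<theta>"
    show "a = a' \<and> b = b'"
    proof (cases "b = b'")
      case False
      then have "\<theta> = (a' - a) / (b - b')" using eq by (simp add: field_simps)
      then have "\<theta> \<in> E" using m by (simp add: Ediv Ediff)
      then show ?thesis using \<theta> by blast
    qed (use eq in auto)
  qed
  have cardW: "card W = q\<^sup>2"
    unfolding W_def card_image[OF injW] by (simp add: card_cartesian_product cardE power2_eq_square)
  have finW: "finite W" by (simp add: W_def finE)
  have WF: "W \<subseteq> F" using EF \<theta> by (auto simp: W_def intro!: Fadd Fmult)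
  have W0: "0 \<in> W" using E0 by (force simp: W_def)
  have Wdiff: "w - w' \<in> W" if "w \<in> W" "w' \<in> W" for w w'
  proof -
    from that obtain a b a' b' where "a \<in> E" "b \<in> E" "a' \<in> E" "b' \<in> E"
      "w = a + b * \<theta>" "w' = a' + b' * \<theta>" by (auto simp: W_def)
    then show ?thesis unfolding W_def
      by (intro image_eqI[of _ _ "(a - a', b - b')"]) (auto simp: algebra_simps Ediff)
  qed
  have Wscale: "e * w \<in> W" if "e \<in> E" "w \<in> W" for e w
  proof -
    from that obtain a b where "a \<in> E" "b \<in> E" "w = a + b * \<theta>" by (auto simp: W_def)
    with that show ?thesis unfolding W_def
      by (intro image_eqI[of _ _ "(e * a, e * b)"]) (auto simp: algebra_simps Emult)
  qed
  \<comment> \<open>Two planes in a three-dimensional space meet in a line; counted as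
    \<open>q\<^sup>4 > q\<^sup>3\<close>.\<close>
  have meet: "\<exists>w\<in>W - {0}. \<exists>w'\<in>W - {0}. w = u * w'" if u: "u \<in> F - {0}" for u
  proof -
    have "(\<lambda>(w, w'). w - u * w') ` (W \<times> W) \<subseteq> F"
      using WF u by (auto intro!: Fdiff Fmult)
    then have "card ((\<lambda>(w, w'). w - u * w') ` (W \<times> W)) \<le> q ^ 3"
      using card_mono[OF finF] cardF by metis
    also have "\<dots> < q ^ 4" using q by (intro power_strict_increasing) auto
    also have "q ^ 4 = card (W \<times> W)"
      by (simp add: card_cartesian_product cardW flip: power_add)
    finally have "\<not> inj_on (\<lambda>(w, w'). w - u * w') (W \<times> W)" by (rule pigeonhole)
    then obtain w1 w1' w2 w2' where w: "w1 \<in> W" "w1' \<in> W" "w2 \<in> W" "w2' \<in> W"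
      and ne: "(w1, w1') \<noteq> (w2, w2')" and "w1 - u * w1' = w2 - u * w2'"
      by (auto simp: inj_on_def)
    then have eq: "w1 - w2 = u * (w1' - w2')" by (simp add: algebra_simps)
    then have "w1 - w2 \<noteq> 0" "w1' - w2' \<noteq> 0" using ne u by auto
    then have "w1 - w2 \<in> W - {0}" "w1' - w2' \<in> W - {0}" using w by (auto intro: Wdiff)
    with eq show ?thesis by blast
  qed

  have \<gamma>F: "\<gamma> ^ i \<in> F" and \<gamma>0: "\<gamma> ^ i \<noteq> 0" for i using gen by auto
  have "\<gamma> ^ Suc M = \<gamma>" using \<gamma>F[of 1] by (simp add: F q3)
  then have \<gamma>M: "\<gamma> ^ M = 1" using \<gamma>0[of 1] by simp
  have \<gamma>mod: "\<gamma> ^ (i mod M) = \<gamma> ^ i" for i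
  proof -
    have "\<gamma> ^ i = \<gamma> ^ (M * (i div M) + i mod M)" by simp
    also have "\<dots> = \<gamma> ^ (i mod M)" by (simp only: power_add power_mult \<gamma>M) simp
    finally show ?thesis by simp
  qed
  have img: "(\<lambda>i. \<gamma> ^ i) ` {..<M} = F - {0}"
  proof
    show "F - {0} \<subseteq> (\<lambda>i. \<gamma> ^ i) ` {..<M}"
      unfolding gen using M0 \<gamma>mod by (auto intro!: image_eqI[of _ _ "_ mod M"])
  qed (auto simp: gen)
  \<comment> \<open>The \<open>M\<close> exponents map onto the \<open>M\<close> nonzero elements of
    \<open>F\<close>, so the order of \<open>\<gamma>\<close> is exactly \<open>M\<close>.\<close>
  have inj: "inj_on (\<lambda>i. \<gamma> ^ i) {..<M}"
    by (rule eq_card_imp_inj_on) (use E0 EF finF in \<open>auto simp: img cardF q3\<close>)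
  \<comment> \<open>Raising to the power \<open>q\<close> multiplies \<open>\<gamma>^(N t)\<close>
    by \<open>\<gamma>^(M t) = 1\<close>. Hence changing an exponent by a multiple of
    \<open>N\<close> is scaling by \<open>E\<close>, which preserves \<open>W\<close>.\<close>
  have scal: "\<gamma> ^ (N * t) \<in> E" for t
  proof -
    have "N * t * q = N * t + M * t" using q by (simp add: MN algebra_simps diff_mult_distrib)
    then have "(\<gamma> ^ (N * t)) ^ q = \<gamma> ^ (N * t) * (\<gamma> ^ M) ^ t"
      by (simp add: power_add flip: power_mult)
    then show ?thesis by (simp add: E \<gamma>M)
  qed

  define D where "D = {i. i < N \<and> \<gamma> ^ i \<in> W}"
  have finD: "finite D" by (simp add: D_def)
  have modD: "i mod N \<in> D" if "\<gamma> ^ i \<in> W" for i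
  proof -
    have "\<gamma> ^ i = \<gamma> ^ (N * (i div N) + i mod N)" by simp
    then have "\<gamma> ^ (i mod N) = (1 / \<gamma> ^ (N * (i div N))) * \<gamma> ^ i"
      unfolding power_add using \<gamma>0 by simp
    moreover have "1 / \<gamma> ^ (N * (i div N)) \<in> E" using Ediv[OF scal[of 0] scal] by simp
    ultimately have "\<gamma> ^ (i mod N) \<in> W" using Wscale that by metis
    then show ?thesis by (simp add: D_def N_def)
  qed
  \<comment> \<open>Each \<open>i\<close> in \<open>D\<close> accounts for \<open>q - 1\<close>
    elements \<open>\<gamma>^(i + N t)\<close> of \<open>W - {0}\<close>, all distinct since the
    exponents stay below \<open>M\<close>. Thus \<open>|D| (q - 1) \<le> q^2 - 1\<close>.\<close>
  have "card (D \<times> {..<q - 1}) \<le> card (W - {0})"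
  proof (rule card_inj_on_le)
    let ?f = "\<lambda>(i, t). \<gamma> ^ (i + N * t)"
    have bound: "i + N * t < M" if "i \<in> D" "t < q - 1" for i t
    proof -
      have "i + N * t < N * Suc t" using that by (simp add: D_def)
      also have "\<dots> \<le> N * (q - 1)" using that by (intro mult_le_mono2) simp
      finally show ?thesis by (simp add: MN mult.commute)
    qed
    show "inj_on ?f (D \<times> {..<q - 1})"
    proof (rule inj_onI, clarify)
      fix i t j s assume h: "i \<in> D" "j \<in> D" "t < q - 1" "s < q - 1"
        "\<gamma> ^ (i + N * t) = \<gamma> ^ (j + N * s)"
      then have eq: "i + N * t = j + N * s"
        by (intro inj_onD[OF inj]) (auto intro: bound)
      have "i < N" "j < N" using h by (auto simp: D_def)
      then have "i = j" using arg_cong[OF eq, of "\<lambda>x. x mod N"] by simp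
      then show "i = j \<and> t = s" using eq \<open>i < N\<close> by simp
    qed
    show "?f ` (D \<times> {..<q - 1}) \<subseteq> W - {0}"
    proof (clarify)
      fix i t assume "i \<in> D"
      then have "\<gamma> ^ (N * t) * \<gamma> ^ i \<in> W" by (intro Wscale scal) (simp add: D_def)
      then show "\<gamma> ^ (i + N * t) \<in> W - {0}" using \<gamma>0 by (simp add: power_add mult.commute)
    qed
  qed (use finW in simp)
  then have "card D * (q - 1) \<le> q\<^sup>2 - 1"
    using W0 finW by (simp add: card_cartesian_product cardW)
  also have "q\<^sup>2 - 1 = (q + 1) * (q - 1)"
    using q by (cases q) (auto simp: power2_eq_square)
  finally have cardD: "card D \<le> q + 1" unfolding mult_le_cancel2 using q by linarith

  have "difference_cover N (int ` D)"
    unfolding difference_cover_def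
  proof (intro conjI allI)
    fix r :: int
    define s where "s = nat (r mod int N)"
    have N0: "N > 0" by (simp add: N_def)
    have s: "int s = r mod int N" using N0 by (simp add: s_def)
    have "\<gamma> ^ s \<in> F - {0}" using \<gamma>F \<gamma>0 by auto
    then obtain w w' where w: "w \<in> W - {0}" "w' \<in> W - {0}" "w = \<gamma> ^ s * w'"
      using meet by blast
    moreover have "w \<in> F - {0}" "w' \<in> F - {0}" using w WF by auto
    ultimately obtain i j where ij: "w = \<gamma> ^ i" "w' = \<gamma> ^ j" unfolding gen by auto
    \<comment> \<open>Comparing exponents gives \<open>i = s + j\<close> modulo \<open>M\<close>,
      hence modulo its divisor \<open>N\<close>; so \<open>r\<close> is congruent to
      \<open>i - j\<close>.\<close>
    have "\<gamma> ^ (i mod M) = \<gamma> ^ ((s + j) mod M)" using w ij by (simp add: \<gamma>mod power_add)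
    then have "i mod M = (s + j) mod M" by (rule inj_onD[OF inj]) (use M0 in auto)
    then have "i mod N = (s + j) mod N" by (metis MN dvd_triv_right mod_mod_cancel)
    then have "int i mod int N = (int s + int j) mod int N"
      by (metis of_nat_add of_nat_mod)
    then have "int N dvd int i - (int s + int j)" by (simp only: mod_eq_dvd_iff)
    moreover have "int N dvd r - int s" unfolding s by (rule dvd_minus_mod)
    moreover have "int N dvd int l - int (l mod N)" for l
      unfolding of_nat_mod by (rule dvd_minus_mod)
    ultimately have "int N dvd (r - int s) - (int i - (int s + int j))
        + ((int i - int (i mod N)) - (int j - int (j mod N)))"
      by (meson dvd_add dvd_diff)
    then have "int N dvd r - (int (i mod N) - int (j mod N))" by (simp add: algebra_simps)
    moreover have "i mod N \<in> D" "j mod N \<in> D" using w ij by (auto intro: modD)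
    ultimately show "\<exists>d\<in>int ` D. \<exists>d'\<in>int ` D. int N dvd r - (d - d')" by blast
  qed (auto simp: D_def)
  moreover have "card (int ` D) \<le> q + 1" using cardD by (simp add: card_image)
  ultimately show ?thesis unfolding N_def by blast
qed

lemma singer_difference_cover_CHAR:
  assumes p: "prime CHAR('a::alg_closed_field)" and k: "k > 0" and q: "q = CHAR('a) ^ k"
  shows "\<exists>D. difference_cover (q\<^sup>2 + q + 1) D \<and> card D \<le> q + 1"
proof -
  define E F where "E = {x::'a. x ^ q = x}" and "F = {x::'a. x ^ (q ^ 3) = x}"
  have q3: "q ^ 3 = CHAR('a) ^ (k * 3)" by (simp add: q power_mult)
  have q1: "q > 1" unfolding q using prime_gt_1_nat[OF p] k by (rule one_less_power)
  have cE: "card E = q" unfolding E_def q using card_frobenius_fixed_points[OF p k] .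
  have cF: "card F = q ^ 3" unfolding F_def q3 by (rule card_frobenius_fixed_points[OF p]) (use k in simp)
  have finF: "finite F" by (rule card_ge_0_finite) (use cF q1 in simp)
  note subE = frobenius_fixed_points_subfield[OF p q]
  note subF = frobenius_fixed_points_subfield[OF p q3]
  obtain \<gamma> where gen: "F - {0} = range (\<lambda>i::nat. \<gamma> ^ i)"
  proof -
    have "\<exists>\<gamma>. F - {0} = range (\<lambda>i::nat. \<gamma> ^ i)"
      by (rule finite_subfield_generator[OF finF]; unfold F_def mem_Collect_eq)
        (rule power_one subF; assumption)+
    then show ?thesis using that by blast
  qed
  show ?thesis
  proof (rule difference_cover_of_cubic_extension[OF q1 cE cF _ _ _ _ _ gen])
    \<comment> \<open>Raising to the power \<open>q^3\<close> is raising to the power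
      \<open>q\<close> three times.\<close>
    show "E \<subseteq> F" by (auto simp: E_def F_def power3_eq_cube power_mult)
  qed (unfold E_def F_def mem_Collect_eq, (rule refl subE subF; assumption)+)
qed

section \<open>Singer covers in characteristics 2 and 3\<close>

lemma CHAR_finite_2: "CHAR(Enum.finite_2) = 2"
  by (rule CHAR_eq_posI) (auto simp: less_Suc_eq numeral_eq_Suc)

lemma CHAR_finite_3: "CHAR(Enum.finite_3) = 3"
proof (rule CHAR_eq_posI)
  fix x :: nat assume "x > 0" "x < 3"
  then have "x = 1 \<or> x = 2" by auto
  then show "of_nat x \<noteq> (0 :: Enum.finite_3)" by auto
qed (simp_all add: numeral_eq_Suc zero_finite_3_def one_finite_3_def plus_finite_3_def)

text \<open>The algebraic closures of the fields with 2 and 3 elements provide the ambient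
  fields.\<close>

lemma singer_difference_cover:
  assumes "p \<in> {2, 3}" "k > 0"
  shows "\<exists>D. difference_cover ((p ^ k)\<^sup>2 + p ^ k + 1) D \<and> card D \<le> p ^ k + 1"
proof -
  have "p = CHAR(Enum.finite_2 alg_closure) \<or> p = CHAR(Enum.finite_3 alg_closure)"
    using assms(1) by (simp add: CHAR_finite_2 CHAR_finite_3)
  then show ?thesis
  proof
    assume p: "p = CHAR(Enum.finite_2 alg_closure)"
    show ?thesis unfolding p
      by (rule singer_difference_cover_CHAR[OF _ assms(2) refl]) (simp add: CHAR_finite_2)
  next
    assume p: "p = CHAR(Enum.finite_3 alg_closure)"
    show ?thesis unfolding p
      by (rule singer_difference_cover_CHAR[OF _ assms(2) refl]) (simp add: CHAR_finite_3)
  qed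
qed


subsection \<open>Density of products of powers and the limit\<close>

lemma ln_2_div_ln_3_irrational: "ln 2 / ln (3::real) \<notin> \<rat>"
proof
  assume "ln 2 / ln (3::real) \<in> \<rat>"
  then obtain m n :: nat where n: "n \<noteq> 0" and "\<bar>ln 2 / ln (3::real)\<bar> = real m / real n"
    by (rule Rats_abs_nat_div_natE)
  then have "real n * ln 2 = real m * ln 3" by (simp add: field_simps)
  then have "ln ((2::real) ^ n) = ln (3 ^ m)" by (simp add: ln_realpow)
  then have "(2::real) ^ n = 3 ^ m" by simp
  then have "real (2 ^ n) = real (3 ^ m)" by simp
  then have "(2::nat) ^ n = 3 ^ m" by (simp only: of_nat_eq_iff)
  moreover have "even ((2::nat) ^ n)" using n by simp
  ultimately show False by (metis even_power odd_numeral)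
qed

text \<open>Irrationality gives \<open>u\<close>, \<open>v\<close> with
  \<open>\<delta> = u \<alpha> - v \<beta>\<close> in \<open>(0, \<epsilon>)\<close>. Start from a
  sum \<open>K \<alpha> + b \<beta>\<close> less than \<open>\<beta>\<close> below \<open>x\<close>
  or equal to \<open>x\<close>; trading \<open>v\<close> copies of \<open>\<beta>\<close> for
  \<open>u\<close> of \<open>\<alpha>\<close> raises it by \<open>\<delta>\<close>, until it first
  reaches \<open>x\<close>.\<close>

lemma semigroup_gaps_tendsto_zero:
  fixes \<alpha> \<beta> \<epsilon> :: real and K :: nat
  assumes pos: "\<alpha> > 0" "\<beta> > 0" and irr: "\<alpha> / \<beta> \<notin> \<rat>" and eps: "\<epsilon> > 0"
  shows "\<exists>x\<^sub>0. \<forall>x\<ge>x\<^sub>0. \<exists>a\<ge>K. \<exists>b\<ge>K. x \<le> real a * \<alpha> + real b * \<beta> \<and> real a * \<alpha> + real b * \<beta> < x + \<epsilon>"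
proof -
  \<comment> \<open>Approximating the target \<open>\<eta>\<close> within \<open>\<eta>\<close>
    gives a value in \<open>(0, 2 \<eta>)\<close>. The first bound yields
    \<open>\<delta> < \<epsilon>\<close>; the cap \<open>1/2\<close> forces
    \<open>h \<ge> 0\<close>, so \<open>nat h\<close> loses nothing.\<close>
  define \<eta> where "\<eta> = min (\<epsilon> / (2 * \<beta>)) (1 / 2)"
  have eta: "\<eta> > 0" using pos eps by (simp add: \<eta>_def)
  obtain h k where k: "k > 0" and hk: "\<bar>of_int k * (\<alpha> / \<beta>) - of_int h - \<eta>\<bar> < \<eta>"
    using sequence_of_fractional_parts_is_dense[OF irr eta] by blast
  define u v where "u = nat k" and "v = nat h"
  have kt: "of_int k * (\<alpha> / \<beta>) > 0" using k pos by simp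
  have lower: "of_int k * (\<alpha> / \<beta>) - of_int h > 0" and upper: "of_int k * (\<alpha> / \<beta>) - of_int h < 2 * \<eta>"
    using hk unfolding abs_less_iff by linarith+
  have "2 * \<eta> \<le> 1" by (simp add: \<eta>_def)
  with upper kt have "real_of_int h > -1" by linarith
  then have "h \<ge> 0" by linarith
  define \<delta> where "\<delta> = real u * \<alpha> - real v * \<beta>"
  have delta_eq: "\<delta> = (of_int k * (\<alpha> / \<beta>) - of_int h) * \<beta>"
    using k \<open>h \<ge> 0\<close> pos by (simp add: \<delta>_def u_def v_def field_simps)
  have delta: "\<delta> > 0" unfolding delta_eq using lower pos by simp
  have "\<delta> < 2 * \<eta> * \<beta>" unfolding delta_eq using upper pos by simp
  also have "\<dots> \<le> \<epsilon>"
  proof -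
    have "\<eta> \<le> \<epsilon> / (2 * \<beta>)" by (simp add: \<eta>_def)
    then show ?thesis using pos by (simp add: field_simps)
  qed
  finally have delta_eps: "\<delta> < \<epsilon>" .
  \<comment> \<open>At most \<open>M\<close> trades are made, as the initial gap is below
    \<open>\<beta>\<close>. They use up at most \<open>v M\<close> copies of \<open>\<beta>\<close>,
    hence the threshold chosen for \<open>x\<close>, which leaves at least \<open>K\<close>.\<close>
  define M where "M = nat \<lceil>\<beta> / \<delta>\<rceil>"
  show ?thesis
  proof (intro exI[of _ "real K * \<alpha> + real (K + v * M) * \<beta>"] allI impI)
    fix x assume x: "real K * \<alpha> + real (K + v * M) * \<beta> \<le> x"
    define y where "y = (x - real K * \<alpha>) / \<beta>"
    have y: "real (K + v * M) \<le> y" using x pos by (simp add: y_def field_simps)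
    define b where "b = nat \<lfloor>y\<rfloor>"
    have y0: "0 \<le> y" using y by (meson of_nat_0_le_iff order_trans)
    have b: "real b \<le> y" "y < real b + 1" using y0 by (auto simp: b_def)
    have bK: "K + v * M \<le> b" using y b(2) by linarith
    define t where "t = x - real K * \<alpha> - real b * \<beta>"
    have t_eq: "t = (y - real b) * \<beta>" using pos by (simp add: t_def y_def field_simps)
    have t: "0 \<le> t" "t < \<beta>" unfolding t_eq using b pos by auto
    define j where "j = nat \<lceil>t / \<delta>\<rceil>"
    have "t / \<delta> \<le> \<beta> / \<delta>" using t delta by (simp add: divide_right_mono)
    then have jM: "j \<le> M" unfolding j_def M_def by (intro nat_mono ceiling_mono)
    have "0 \<le> t / \<delta>" using t delta by simp
    then have j: "t / \<delta> \<le> real j" "real j < t / \<delta> + 1" unfolding j_def by linarith+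
    have j': "t \<le> real j * \<delta>" "real j * \<delta> < t + \<delta>"
      using j delta by (simp_all add: field_simps)
    have "j * v \<le> v * M" using jM by (simp add: mult.commute)
    then have jv: "j * v + K \<le> b" using bK by linarith
    have sum: "real (K + j * u) * \<alpha> + real (b - j * v) * \<beta> = x - t + real j * \<delta>"
      using jv by (simp add: of_nat_diff t_def \<delta>_def algebra_simps)
    show "\<exists>a\<ge>K. \<exists>b\<ge>K. x \<le> real a * \<alpha> + real b * \<beta> \<and> real a * \<alpha> + real b * \<beta> < x + \<epsilon>"
      by (rule exI[of _ "K + j * u"], rule conjI, simp, rule exI[of _ "b - j * v"])
        (use jv j' delta_eps sum in auto)
  qed
qed

section \<open>Asymptotic comparison and convergence\<close>

lemma eta_le_of_powers:
  assumes n: "n > 0" and ab: "a > 0" "b > 0" and m: "m \<le> n * (2 ^ a * 3 ^ b)\<^sup>2"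
  shows "eta g m \<le> (2 ^ a + 1) * (3 ^ b + 1) * eta g n"
proof -
  define M N :: nat where "M = (2 ^ a)\<^sup>2 + 2 ^ a + 1" and "N = (3 ^ b)\<^sup>2 + 3 ^ b + 1"
  obtain D E where D: "difference_cover M D" "card D \<le> 2 ^ a + 1"
    and E: "difference_cover N E" "card E \<le> 3 ^ b + 1"
    using singer_difference_cover[of 2 a] singer_difference_cover[of 3 b] ab
    unfolding M_def N_def by auto
  \<comment> \<open>The moduli exceed the squares \<open>(2^a)^2\<close> and \<open>(3^b)^2\<close>,
    so by monotonicity it suffices to bound \<open>eta\<close> at \<open>n M N\<close>.\<close>
  have "(2 ^ a * 3 ^ b)\<^sup>2 \<le> M * N"
    unfolding power_mult_distrib M_def N_def by (intro mult_le_mono) auto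
  then have "m \<le> n * M * N" using m by (metis mult.assoc mult_le_mono2 order_trans)
  then have "eta g m \<le> eta g (n * M * N)" by (rule eta_mono)
  also have "\<dots> \<le> card E * eta g (n * M)"
    by (rule eta_mult_le[OF _ E(1)]) (use n in \<open>simp add: M_def\<close>)
  also have "\<dots> \<le> card E * (card D * eta g n)"
    by (intro mult_le_mono2 eta_mult_le n D)
  also have "\<dots> \<le> (3 ^ b + 1) * ((2 ^ a + 1) * eta g n)"
    by (intro mult_le_mono D E order_refl)
  finally show ?thesis by (simp only: ac_simps)
qed

lemma eta_ratio_eventually_le:
  fixes c :: real
  assumes n: "n > 0" and c: "c > 1"
  shows "\<forall>\<^sub>F m in sequentially. eta g m / sqrt m \<le> c * (eta g n / sqrt n)"
proof -
  \<comment> \<open>Three factors \<open>exp s\<close> make up \<open>c\<close>: one each for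
    replacing \<open>2^a + 1\<close> by \<open>2^a\<close> and \<open>3^b + 1\<close> by
    \<open>3^b\<close>, one for \<open>2^a 3^b\<close> overshooting
    \<open>sqrt (m / n)\<close>.\<close>
  define s where "s = ln c / 3"
  have s: "s > 0" using c by (simp add: s_def)
  have "exp s > 1" using s by simp
  then obtain K0 where K0: "(1 / 2 :: real) ^ K0 < exp s - 1"
    using real_arch_pow_inv[of "exp s - 1" "1 / 2"] by auto
  \<comment> \<open>The successor keeps both exponents positive, as the Singer covers
    require.\<close>
  define K where "K = Suc K0"
  have small: "r ^ i + 1 \<le> exp s * r ^ i" if "i \<ge> K" "r \<ge> 2" for r :: real and i
  proof -
    have "1 = (1 / 2 :: real) ^ i * 2 ^ i" by (simp add: power_divide)
    also have "\<dots> \<le> (1 / 2) ^ i * r ^ i" using that by (intro mult_left_mono power_mono) auto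
    also have "\<dots> \<le> (1 / 2) ^ K0 * r ^ i"
      using that by (intro mult_right_mono power_decreasing) (auto simp: K_def)
    also have "\<dots> \<le> (exp s - 1) * r ^ i" using K0 that by (intro mult_right_mono) auto
    finally show ?thesis by (simp add: algebra_simps)
  qed
  obtain x\<^sub>0 where x\<^sub>0: "\<And>x. x \<ge> x\<^sub>0 \<Longrightarrow> \<exists>a\<ge>K. \<exists>b\<ge>K.
      x \<le> real a * ln 2 + real b * ln 3 \<and> real a * ln 2 + real b * ln 3 < x + s"
    using semigroup_gaps_tendsto_zero[OF _ _ ln_2_div_ln_3_irrational s, of K] by auto
  have "\<forall>\<^sub>F m in sequentially. real m \<ge> real n * exp (2 * x\<^sub>0) \<and> m > 0"
    using filterlim_real_sequentially eventually_gt_at_top[of 0]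
    by (intro eventually_conj) (auto simp: filterlim_at_top)
  then show ?thesis
  proof eventually_elim
    case (elim m)
    then have m: "m > 0" and mX: "real n * exp (2 * x\<^sub>0) \<le> real m" by auto
    define x where "x = ln (sqrt (real m / real n))"
    have exp_x: "exp x = sqrt (real m / real n)" using m n by (simp add: x_def)
    have "exp (2 * x\<^sub>0) \<le> real m / real n" using mX n by (simp add: field_simps)
    then have "sqrt ((exp x\<^sub>0)\<^sup>2) \<le> exp x"
      unfolding exp_x by (subst real_sqrt_le_iff) (simp add: exp_double)
    then have "x\<^sub>0 \<le> x" by simp
    from x\<^sub>0[OF this] obtain a b where ab: "a \<ge> K" "b \<ge> K"
      and x: "x \<le> real a * ln 2 + real b * ln 3" "real a * ln 2 + real b * ln 3 < x + s" by blast
    have pw: "exp (real a * ln 2 + real b * ln 3) = 2 ^ a * 3 ^ b"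
      by (simp add: exp_add exp_of_nat_mult)
    have lo: "sqrt (real m / real n) \<le> 2 ^ a * 3 ^ b"
      using x(1) unfolding pw[symmetric] exp_x[symmetric] by simp
    have hi: "2 ^ a * 3 ^ b \<le> sqrt (real m / real n) * exp s"
      using x(2) unfolding pw[symmetric] exp_x[symmetric] exp_add[symmetric] by simp
    have "real m / real n \<le> (2 ^ a * 3 ^ b)\<^sup>2"
      using lo by (rule sqrt_le_D)
    then have "real m \<le> real (n * (2 ^ a * 3 ^ b)\<^sup>2)" using n by (simp add: field_simps)
    then have "m \<le> n * (2 ^ a * 3 ^ b)\<^sup>2" by (simp only: of_nat_le_iff)
    then have "eta g m \<le> (2 ^ a + 1) * (3 ^ b + 1) * eta g n"
      by (intro eta_le_of_powers n) (use ab in \<open>auto simp: K_def\<close>)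
    then have "real (eta g m) \<le> real ((2 ^ a + 1) * (3 ^ b + 1) * eta g n)"
      by (simp only: of_nat_le_iff)
    then have "real (eta g m) \<le> (2 ^ a + 1) * (3 ^ b + 1) * real (eta g n)" by (simp add: algebra_simps)
    also have "\<dots> \<le> (exp s * 2 ^ a) * (exp s * 3 ^ b) * real (eta g n)"
      by (intro mult_right_mono mult_mono small ab) auto
    also have "\<dots> = exp s * exp s * (2 ^ a * 3 ^ b) * real (eta g n)" by (simp add: ac_simps)
    also have "\<dots> \<le> exp s * exp s * (sqrt (real m / real n) * exp s) * real (eta g n)"
      by (intro mult_right_mono mult_left_mono hi) auto
    also have "\<dots> = exp (s + s + s) * sqrt (real m / real n) * real (eta g n)"
      by (simp only: exp_add ac_simps)
    also have "exp (s + s + s) = c" using c by (simp add: s_def)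
    finally show ?case using m n by (simp add: real_sqrt_divide field_simps)
  qed
qed

theorem theorem1:
  fixes g :: nat
  assumes "g > 0"
  shows "\<exists>L::real. L > 0 \<and> (\<lambda>n. real (eta g n) / sqrt (real n)) \<longlonglongrightarrow> L"
proof -
  define h where "h = (\<lambda>n. real (eta g n) / sqrt (real n))"
  \<comment> \<open>Index 0 is excluded: division by zero makes \<open>h 0 = 0\<close>, which would
    pull the infimum down to 0.\<close>
  define L where "L = Inf (h ` {0<..})"
  have h1: "1 \<le> h n" if "n > 0" for n
  proof -
    have "real n \<le> real ((eta g n)\<^sup>2)" using le_eta_square[OF assms] by (simp only: of_nat_le_iff)
    then have "sqrt (real n) \<le> sqrt ((real (eta g n))\<^sup>2)" by (intro real_sqrt_le_mono) simp
    then show ?thesis using that by (simp add: h_def field_simps)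
  qed
  have "1 \<le> L" unfolding L_def by (rule cInf_greatest) (auto simp: Suc_le_eq intro: h1)
  have bdd: "bdd_below (h ` {0<..})" by (rule bdd_belowI[of _ 1]) (auto intro: h1)
  have Lh: "L \<le> h n" if "n > 0" for n unfolding L_def
    by (rule cInf_lower[OF _ bdd]) (use that in auto)
  have "h \<longlonglongrightarrow> L"
  proof (rule order_tendstoI)
    fix y assume "y < L"
    show "\<forall>\<^sub>F m in sequentially. y < h m"
      using eventually_gt_at_top[of 0]
      by (rule eventually_mono) (rule less_le_trans[OF \<open>y < L\<close> Lh])
  next
    fix y assume "L < y"
    then obtain n where n: "n > 0" "h n < y"
      unfolding L_def using cInf_less_iff[OF _ bdd, of y] by auto
    have "1 < y / h n" using n h1[OF n(1)] by (simp add: field_simps)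
    \<comment> \<open>The slack between \<open>h n\<close> and \<open>y\<close> absorbs the factor
      \<open>c > 1\<close> lost in the eventual comparison with \<open>h n\<close>.\<close>
    then obtain c where c: "1 < c" "c < y / h n" using dense by blast
    then have less: "c * h n < y" using h1[OF n(1)] by (simp add: field_simps)
    have "\<forall>\<^sub>F m in sequentially. h m \<le> c * h n"
      unfolding h_def by (rule eta_ratio_eventually_le[OF n(1) c(1)])
    then show "\<forall>\<^sub>F m in sequentially. h m < y"
      by (rule eventually_mono) (rule le_less_trans[OF _ less])
  qed
  then show ?thesis using \<open>1 \<le> L\<close> unfolding h_def by (intro exI[of _ L]) auto
qed

end
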